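(* Let $\mathcal{F}:\mathbb{R}^d\to\mathbb{R}$ be the differentiable energy $\mathcal{F}(\theta) = \mathcal{L}_{\mathrm{pred}}(\theta) + \beta\widetilde{\mathcal{H}}(\widetilde{Z}_\theta) + \gamma\Omega(\theta) + \lambda\mathcal{R}_{\mathrm{dec}}(\theta)$. Let $\{\theta_t\}_{t\ge 0}$ be generated by $\theta_{t+1} = \theta_t - \eta\nabla\mathcal{F}(\theta_t)$. Assume that: (i) there exists $L>0$ such that, for all iterates $\theta_t$ and $\theta_{t+1}$, $$\mathcal{F}(\theta_{t+1}) \le \mathcal{F}(\theta_t) + \nabla\mathcal{F}(\theta_t)^\top(\theta_{t+1}-\theta_t) + \frac{L}{2}\|\theta_{t+1}-\theta_t\|^2;$$ (ii) there exists $\mathcal{F}^\star>-\infty$ such that $\mathcal{F}(\theta)\ge\mathcal{F}^\star$ for all $\theta$; (iii) $0<\eta<1/L$. Then $$\liminf_{t\to\infty}\|\nabla\mathcal{F}(\theta_t)\| = 0.$$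
   Context: The parameter is $\theta\in\mathbb{R}^d$. $\mathcal{L}_{\mathrm{pred}}$ is a predictive loss, $\Omega$ a structural penalty, $\mathcal{R}_{\mathrm{dec}}$ a decision-aware risk, and $\widetilde{\mathcal{H}}(\widetilde{Z}_\theta)$ a differentiable real-valued entropy surrogate of the noisy representation $\widetilde{Z}_\theta = h_\theta(X)+\xi$, where $h_\theta(X)$ is a hidden representation of the random input $X$ and $\xi\sim\mathcal{N}(0,\sigma_\xi^2 I)$ is independent of $X$; $\beta,\gamma,\lambda$ are constant coefficients. No structure of $\mathcal{F}$ is assumed beyond differentiability and (i)-(ii). *)

theory Defs
  imports "HOL-Probability.Probability"
begin

definition gradient :: "('a::real_inner \<Rightarrow> real) \<Rightarrow> 'a \<Rightarrow> 'a" where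
  "gradient f x = (THE g. GDERIV f x :> g)"

lemma GDERIV_unique:
  fixes f :: "'a::real_inner \<Rightarrow> real"
  assumes "GDERIV f x :> g" "GDERIV f x :> g'"
  shows "g = g'"
proof -
  have "(\<lambda>h. h \<bullet> g) = (\<lambda>h. h \<bullet> g')"
    using assms unfolding gderiv_def by (rule has_derivative_unique)
  then show ?thesis
    by (metis inner_commute vector_eq_ldot)
qed

lemma gradient_eqI: "GDERIV f x :> g \<Longrightarrow> gradient f x = g"
  unfolding gradient_def by (blast intro: GDERIV_unique)

lemma GDERIV_gradient:
  fixes f :: "'a::euclidean_space \<Rightarrow> real"
  assumes "f differentiable (at x)"
  shows "GDERIV f x :> gradient f x"
proof -
  obtain D where D: "(f has_derivative D) (at x)"
    using assms by (auto simp: differentiable_def)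
  then have "linear D" by (rule has_derivative_linear)
  have "D h = h \<bullet> (\<Sum>b\<in>Basis. D b *\<^sub>R b)" for h
  proof -
    have "D h = D (\<Sum>b\<in>Basis. (h \<bullet> b) *\<^sub>R b)"
      by (simp add: euclidean_representation)
    also have "\<dots> = (\<Sum>b\<in>Basis. (h \<bullet> b) * D b)"
      using \<open>linear D\<close> by (simp add: linear_sum linear_cmul)
    finally show ?thesis
      by (simp add: inner_sum_right mult.commute)
  qed
  then have "D = (\<lambda>h. h \<bullet> (\<Sum>b\<in>Basis. D b *\<^sub>R b))"
    by (rule ext)
  with D have "GDERIV f x :> (\<Sum>b\<in>Basis. D b *\<^sub>R b)"
    by (simp add: gderiv_def)
  then show ?thesis
    by (simp add: gradient_eqI)
qed

definition std_gaussian :: "(real ^ 'k) measure" where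
  "std_gaussian = density lborel (\<lambda>z. ennreal (\<Prod>i\<in>UNIV. std_normal_density (z $ i)))"

text \<open>The law \<open>N(0, s\<^sup>2 I)\<close>, as the image of the standard Gaussian law under \<open>z \<mapsto> s z\<close>.
  This also covers the degenerate case \<open>s = 0\<close>, where the law is the point mass at the origin.\<close>

definition isotropic_gaussian :: "real \<Rightarrow> (real ^ 'k) measure" where
  "isotropic_gaussian s = distr std_gaussian borel (\<lambda>z. s *\<^sub>R z)"

lemma prob_space_std_gaussian: "prob_space (std_gaussian :: (real ^ 'k) measure)"
proof (rule prob_spaceI)
  have eq: "(\<Prod>i\<in>UNIV. std_normal_density (z $ i)) = (\<Prod>b\<in>Basis. std_normal_density (z \<bullet> b))"
    for z :: "real ^ 'k"
  proof -
    have "inj (\<lambda>i::'k. axis i (1::real))"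
      by (auto simp: inj_on_def axis_eq_axis)
    then show ?thesis
      by (simp add: Basis_vec_def UNION_singleton_eq_range prod.reindex inner_axis)
  qed
  have "emeasure (std_gaussian :: (real ^ 'k) measure) (space std_gaussian)
      = (\<integral>\<^sup>+z. (\<Prod>b\<in>Basis. ennreal (std_normal_density (z \<bullet> b))) \<partial>(lborel :: (real ^ 'k) measure))"
    unfolding std_gaussian_def by (simp add: emeasure_density eq prod_ennreal)
  also have "\<dots> = (\<Prod>b\<in>(Basis :: (real ^ 'k) set). \<integral>\<^sup>+x. ennreal (std_normal_density x) \<partial>lborel)"
    by (rule nn_integral_lborel_prod) auto
  also have "(\<integral>\<^sup>+x. ennreal (std_normal_density x) \<partial>lborel) = 1"
    using prob_space.emeasure_space_1[OF prob_space_normal_density[of 1 0]]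
    by (simp add: emeasure_density)
  finally show "emeasure (std_gaussian :: (real ^ 'k) measure) (space std_gaussian) = 1"
    by simp
qed

lemma isotropic_gaussian_eq_density:
  assumes s: "0 < s"
  shows "isotropic_gaussian s
    = density lborel (\<lambda>z :: real ^ 'k. ennreal (\<Prod>i\<in>UNIV. normal_density 0 s (z $ i)))"
proof -
  let ?T = "\<lambda>z :: real ^ 'k. s *\<^sub>R z"
  let ?g = "\<lambda>z :: real ^ 'k. ennreal (\<Prod>i\<in>UNIV. normal_density 0 s (z $ i))"
  have [measurable]: "?g \<in> borel_measurable borel" by measurable
  have one: "s * normal_density 0 s (s * x) = std_normal_density x" for x
    using s by (simp add: normal_density_def real_sqrt_mult power_mult_distrib)
  have pt: "ennreal (s ^ CARD('k)) * ?g (?T z) = ennreal (\<Prod>i\<in>UNIV. std_normal_density (z $ i))" for z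
  proof -
    have "s ^ CARD('k) * (\<Prod>i\<in>UNIV. normal_density 0 s (s * z $ i))
        = (\<Prod>i\<in>UNIV. s * normal_density 0 s (s * z $ i))"
      by (simp add: prod.distrib)
    then show ?thesis
      using s by (simp add: one ennreal_mult'[symmetric])
  qed
  have "density lborel ?g
      = density (density (distr lborel borel ?T) (\<lambda>_. ennreal (s ^ CARD('k)))) ?g"
    using lborel_affine[of s "0 :: real ^ 'k"] s by (simp add: ennreal_power)
  also have "\<dots> = density (distr lborel borel ?T) (\<lambda>z. ennreal (s ^ CARD('k)) * ?g z)"
    by (subst density_density_eq) auto
  also have "\<dots> = distr (density lborel (\<lambda>z. ennreal (s ^ CARD('k)) * ?g (?T z))) borel ?T"
    by (subst density_distr) auto
  also have "\<dots> = isotropic_gaussian s"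
    unfolding isotropic_gaussian_def std_gaussian_def pt ..
  finally show ?thesis ..
qed

text \<open>The library's \<open>indep_var\<close> requires both random variables to have the same value type;
  here the value types may differ.\<close>

definition indep_rv ::
  "'w measure \<Rightarrow> 'x measure \<Rightarrow> ('w \<Rightarrow> 'x) \<Rightarrow> 'y measure \<Rightarrow> ('w \<Rightarrow> 'y) \<Rightarrow> bool" where
  "indep_rv M S X T Y \<longleftrightarrow>
    X \<in> M \<rightarrow>\<^sub>M S \<and> Y \<in> M \<rightarrow>\<^sub>M T \<and>
    prob_space.indep_set M {X -` A \<inter> space M | A. A \<in> sets S} {Y -` B \<inter> space M | B. B \<in> sets T}"

lemma indep_rv_iff_indep_var:
  assumes "prob_space M"
  shows "indep_rv M S X T Y \<longleftrightarrow> prob_space.indep_var M S X T Y"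
proof -
  have *: "sigma_sets (space M) {f -` A \<inter> space M | A. A \<in> sets N}
      = {f -` A \<inter> space M | A. A \<in> sets N}" if "f \<in> M \<rightarrow>\<^sub>M N" for f :: "'a \<Rightarrow> 'b" and N
    using sets_vimage_algebra2[of f "space M" N] sets_vimage_algebra[of "space M" f N] that
    by (auto simp: measurable_def)
  show ?thesis
    unfolding indep_rv_def prob_space.indep_var_eq[OF assms] by (auto simp: *)
qed

definition noisy_representation ::
  "('p \<Rightarrow> 'x \<Rightarrow> 'b::plus) \<Rightarrow> ('w \<Rightarrow> 'x) \<Rightarrow> ('w \<Rightarrow> 'b) \<Rightarrow> 'p \<Rightarrow> 'w \<Rightarrow> 'b" where
  "noisy_representation h X \<xi> \<theta> = (\<lambda>\<omega>. h \<theta> (X \<omega>) + \<xi> \<omega>)"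

end

theory Submission
  imports Defs
begin

text \<open>By the descent inequality, a step lowers \<open>F\<close> by at least \<open>c \<parallel>\<nabla>F(\<theta>\<^sub>t)\<parallel>\<^sup>2\<close> with
  \<open>c = \<eta> (1 - L \<eta> / 2) > 0\<close>. The values \<open>F(\<theta>\<^sub>t)\<close> therefore decrease and, being bounded below,
  converge, so their decrements vanish in the limit and the whole sequence of gradient norms tends
  to \<open>0\<close>.\<close>

text \<open>The decrements of \<open>b\<close> dominate \<open>a\<close>, and they vanish because
  \<open>b\<close> and its shift share one limit. Below, \<open>b\<close> is the energy along the
  iterates and \<open>a\<close> the scaled squared gradient norm.\<close>

lemma sufficient_decrease_tendsto_zero:
  fixes a b :: "nat \<Rightarrow> real"
  assumes decrease: "\<And>n. b (Suc n) \<le> b n - a n"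
    and nonneg: "\<And>n. 0 \<le> a n"
    and bounded_below: "\<And>n. m \<le> b n"
  shows "a \<longlonglongrightarrow> 0"
proof -
  have "decseq b"
    using decrease nonneg by (intro decseq_SucI) (smt (verit))
  then obtain l where "b \<longlonglongrightarrow> l"
    using decseq_convergent bounded_below by blast
  then have "(\<lambda>n. b n - b (Suc n)) \<longlonglongrightarrow> l - l"
    by (intro tendsto_diff LIMSEQ_Suc)
  then have "(\<lambda>n. b n - b (Suc n)) \<longlonglongrightarrow> 0"
    by simp
  \<comment> \<open>Squeeze: nonnegativity turns the norm of \<open>a n\<close> into
    \<open>a n\<close> itself, which is at most \<open>b n - b (Suc n)\<close>.\<close>
  then show ?thesis
    by (rule Lim_null_comparison[rotated])
      (use decrease nonneg in \<open>simp add: algebra_simps\<close>)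
qed

theorem theorem1:
  fixes M :: "'w measure" and S :: "'x measure"
    and X :: "'w \<Rightarrow> 'x"
    and h :: "real ^ 'd \<Rightarrow> 'x \<Rightarrow> real ^ 'k"
    and \<xi> :: "'w \<Rightarrow> real ^ 'k" and \<sigma> :: real
    and H :: "('w \<Rightarrow> real ^ 'k) \<Rightarrow> real"
    and L_pred \<Omega> R_dec F :: "real ^ 'd \<Rightarrow> real"
    and \<beta> \<gamma> lam L \<eta> F_star :: real
    and \<theta> :: "nat \<Rightarrow> real ^ 'd"
  assumes prob: "prob_space M"
    and h_meas: "\<And>p. h p \<in> S \<rightarrow>\<^sub>M borel"
    and noise_law: "distr M borel \<xi> = isotropic_gaussian \<sigma>"
    and noise_indep: "indep_rv M S X borel \<xi>"
    and entropy_diff: "\<And>p. (\<lambda>q. H (noisy_representation h X \<xi> q)) differentiable (at p)"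
    and energy: "\<And>p. F p = L_pred p + \<beta> * H (noisy_representation h X \<xi> p) + \<gamma> * \<Omega> p + lam * R_dec p"
    and energy_diff: "\<And>p. F differentiable (at p)"
    and iterates: "\<And>t. \<theta> (Suc t) = \<theta> t - \<eta> *\<^sub>R gradient F (\<theta> t)"
    and L_pos: "L > 0"
    and descent: "\<And>t. F (\<theta> (Suc t)) \<le> F (\<theta> t) + gradient F (\<theta> t) \<bullet> (\<theta> (Suc t) - \<theta> t)
                      + L / 2 * (norm (\<theta> (Suc t) - \<theta> t))\<^sup>2"
    and bounded_below: "\<And>p. F_star \<le> F p"
    and step: "0 < \<eta>" "\<eta> < 1 / L"
  shows "liminf (\<lambda>t. ereal (norm (gradient F (\<theta> t)))) = 0"
proof -
  define g where "g t = gradient F (\<theta> t)" for t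
  define c where "c = \<eta> * (1 - L * \<eta> / 2)"
  \<comment> \<open>This makes the second factor of \<open>c\<close> exceed 1/2.\<close>
  have "L * \<eta> < 1"
    using step L_pos by (simp add: field_simps)
  then have "0 < c"
    unfolding c_def using step by (intro mult_pos_pos) auto
  have "(\<lambda>t. c * (norm (g t))\<^sup>2) \<longlonglongrightarrow> 0"
  proof (rule sufficient_decrease_tendsto_zero)
    \<comment> \<open>For the step \<open>- \<eta> *\<^sub>R g t\<close>, the linear term is
      \<open>- \<eta> * (norm (g t))\<^sup>2\<close> and the quadratic one
      \<open>L * \<eta>\<^sup>2 / 2 * (norm (g t))\<^sup>2\<close>; their sum has coefficient
      \<open>- c\<close>.\<close>
    show "F (\<theta> (Suc t)) \<le> F (\<theta> t) - c * (norm (g t))\<^sup>2" for t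
      using descent[of t]
      by (simp add: iterates g_def c_def dot_square_norm power_mult_distrib power2_eq_square
          algebra_simps)
    show "0 \<le> c * (norm (g t))\<^sup>2" for t
      using \<open>0 < c\<close> by simp
  qed (rule bounded_below)
  then have "(\<lambda>t. (norm (g t))\<^sup>2) \<longlonglongrightarrow> 0"
    using \<open>0 < c\<close> tendsto_mult_left_iff[of c "\<lambda>t. (norm (g t))\<^sup>2" 0] by simp
  then have "(\<lambda>t. norm (g t)) \<longlonglongrightarrow> 0"
    by simp
  then have "(\<lambda>t. ereal (norm (g t))) \<longlonglongrightarrow> 0"
    by (simp add: zero_ereal_def)
  \<comment> \<open>A convergent sequence has its limit as liminf.\<close>
  then show ?thesis
    unfolding g_def by (rule lim_imp_Liminf[OF sequentially_bot])
qed

end
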